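(* Let $H^2_\beta(\mathbb U_{\mathbb{BC}})$ be a bicomplex weighted Hardy space with generating function $T(Z)=\sum_{n=0}^\infty \frac{Z^n}{\beta(n)^2}$. For each $W\in\mathbb U_{\mathbb{BC}}$, evaluation at $W$, $f\mapsto f(W)$, is a $\mathbb D$-bounded bicomplex linear functional on $H^2_\beta(\mathbb U_{\mathbb{BC}})$, and for every $f\in H^2_\beta(\mathbb U_{\mathbb{BC}})$, $$f(W)=\langle f,K_W\rangle_{H^2_\beta(\mathbb U_{\mathbb{BC}})},\qquad\text{where } K_W(Z)=T(W^{\dagger_3}Z).$$
   Context: Bicomplex numbers: $\mathbb{BC}=\{z+jw : z,w\in\mathbb C(i)\}$, a commutative ring with $i^2=j^2=-1$, $ij=ji$; $\mathbb C(i)$ is the complex field with imaginary unit $i$. Put $e_1=\frac{1+ij}{2}$, $e_2=\frac{1-ij}{2}$; these are idempotents with $e_1e_2=0$, $e_1+e_2=1$, and every $Z=z+jw$ is uniquely $Z=e_1z_1+e_2z_2$ with $z_1=z-iw$, $z_2=z+iw\in\mathbb C(i)$. The conjugation $\dagger_3$ is $Z^{\dagger_3}=\bar z-j\bar w=e_1\overline{z_1}+e_2\overline{z_2}$. Hyperbolic numbers: $\mathbb D=\{e_1\alpha_1+e_2\alpha_2:\alpha_1,\alpha_2\in\mathbb R\}$, $\mathbb D^+=\{e_1\alpha_1+e_2\alpha_2:\alpha_1,\alpha_2\ge 0\}$, and $\alpha\leq'\beta$ means $\beta-\alpha\in\mathbb D^+$. The hyperbolic modulus is $|Z|_k=e_1|z_1|+e_2|z_2|\in\mathbb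 D^+$. Convergence, quotients and square roots are componentwise with respect to $e_1,e_2$. $\mathbb U$ is the open unit disc of $\mathbb C(i)$ and $\mathbb U_{\mathbb{BC}}=\{e_1z_1+e_2z_2: z_1,z_2\in\mathbb U\}$. A function $f:\mathbb U_{\mathbb{BC}}\to\mathbb{BC}$ is bicomplex holomorphic if it has a bicomplex derivative at each point; equivalently $f(e_1z_1+e_2z_2)=e_1f_1(z_1)+e_2f_2(z_2)$ with $f_1,f_2$ holomorphic on $\mathbb U$. Weighted Hardy space: let $\beta(n)=e_1\beta_1(n)+e_2\beta_2(n)$, $n\ge0$, with $\beta_1(n),\beta_2(n)>0$, be a sequence such that every power series $\sum a_nZ^n$ ($a_n\in\mathbb{BC}$) with $\sum|a_n|_k^2\beta(n)^2$ convergent in $\mathbb D$ defines a bicomplex holomorphic function on $\mathbb U_{\mathbb{BC}}$. Then $H^2_\beta(\mathbb U_{\mathbb{BC}})$ is the bicomplex Hilbert space of all such functions $f(Z)=\sum a_nZ^n$ with $\sum|a_n|_k^2\beta(n)^2$ convergent, with $\mathbb{BC}$-valued inner product $\left\langle\sum a_nZ^n,\sum b_nZ^n\right\rangle=\sum a_n b_n^{\dagger_3}\beta(n)^2$ and $\mathbb D$-valued norm $\|f\|_{\mathbb D}^2=\langle f,f\rangle=\sum|a_n|_k^2\beta(n)^2$. A $\mathbb{BC}$-linear functional $E$ is $\mathbb D$-bounded if there is $M\in\mathbb D^+$ with $|E(f)|_k\leq'M\|f\|_{\mathbb D}$ for all $f$. *)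

theory Defs
  imports "HOL-Complex_Analysis.Complex_Analysis"
begin

section \<open>Bicomplex numbers\<close>

text \<open>\<open>Bicomplex z w\<close> is \<open>z + j w\<close>; see \<open>bicomplex_decomp\<close>.\<close>

datatype bicomplex = Bicomplex (bc_fst: complex) (bc_snd: complex)

lemma bicomplex_eq_iff: "Z = W \<longleftrightarrow> bc_fst Z = bc_fst W \<and> bc_snd Z = bc_snd W"
  by (cases Z; cases W) simp

instantiation bicomplex :: comm_ring_1
begin

definition "0 = Bicomplex 0 0"
definition "1 = Bicomplex 1 0"
definition "Z + W = Bicomplex (bc_fst Z + bc_fst W) (bc_snd Z + bc_snd W)"
definition "Z - W = Bicomplex (bc_fst Z - bc_fst W) (bc_snd Z - bc_snd W)"
definition "- Z = Bicomplex (- bc_fst Z) (- bc_snd Z)"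
definition "Z * W = Bicomplex (bc_fst Z * bc_fst W - bc_snd Z * bc_snd W)
                              (bc_fst Z * bc_snd W + bc_snd Z * bc_fst W)"

instance
  by standard
    (simp_all add: bicomplex_eq_iff zero_bicomplex_def one_bicomplex_def plus_bicomplex_def
      minus_bicomplex_def uminus_bicomplex_def times_bicomplex_def algebra_simps)

end

lemma bc_components [simp]:
  "bc_fst 0 = 0" "bc_snd 0 = 0" "bc_fst 1 = 1" "bc_snd 1 = 0"
  "bc_fst (Z + W) = bc_fst Z + bc_fst W" "bc_snd (Z + W) = bc_snd Z + bc_snd W"
  "bc_fst (Z - W) = bc_fst Z - bc_fst W" "bc_snd (Z - W) = bc_snd Z - bc_snd W"
  "bc_fst (- Z) = - bc_fst Z" "bc_snd (- Z) = - bc_snd Z"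
  "bc_fst (Z * W) = bc_fst Z * bc_fst W - bc_snd Z * bc_snd W"
  "bc_snd (Z * W) = bc_fst Z * bc_snd W + bc_snd Z * bc_fst W"
  by (simp_all add: zero_bicomplex_def one_bicomplex_def plus_bicomplex_def
      minus_bicomplex_def uminus_bicomplex_def times_bicomplex_def)

instantiation bicomplex :: real_vector
begin

definition "scaleR r Z = Bicomplex (r *\<^sub>R bc_fst Z) (r *\<^sub>R bc_snd Z)"

instance
  by standard (simp_all add: bicomplex_eq_iff scaleR_bicomplex_def algebra_simps)

end

text \<open>The norm is the Euclidean norm of \<open>(z, w)\<close>.  Its topology is that of componentwise
  convergence with respect to \<open>e\<^sub>1, e\<^sub>2\<close>; see \<open>bc_tendsto_iff\<close> and \<open>bc_sums_iff\<close>.\<close>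

instantiation bicomplex :: real_normed_vector
begin

definition "norm Z = norm (bc_fst Z, bc_snd Z)"
definition "sgn (Z :: bicomplex) = Z /\<^sub>R norm Z"
definition "dist (Z :: bicomplex) W = norm (Z - W)"
definition uniformity_bicomplex_def [code del]:
  "(uniformity :: (bicomplex \<times> bicomplex) filter)
     = (INF e\<in>{0 <..}. principal {(x, y). dist x y < e})"
definition open_bicomplex_def [code del]:
  "open (U :: bicomplex set) \<longleftrightarrow> (\<forall>x\<in>U. eventually (\<lambda>(x', y). x' = x \<longrightarrow> y \<in> U) uniformity)"

instance
proof
  fix r :: real and Z W :: bicomplex
  show "(norm Z = 0) = (Z = 0)"
    by (simp add: norm_bicomplex_def bicomplex_eq_iff zero_prod_def)
  show "norm (Z + W) \<le> norm Z + norm W"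
    using norm_triangle_ineq [of "(bc_fst Z, bc_snd Z)" "(bc_fst W, bc_snd W)"]
    by (simp add: norm_bicomplex_def)
  show "norm (r *\<^sub>R Z) = \<bar>r\<bar> * norm Z"
    using norm_scaleR [of r "(bc_fst Z, bc_snd Z)"]
    by (simp only: norm_bicomplex_def scaleR_bicomplex_def bicomplex.sel scaleR_Pair)
qed (rule sgn_bicomplex_def dist_bicomplex_def open_bicomplex_def uniformity_bicomplex_def)+

end

lemma bc_fst_scaleR [simp]: "bc_fst (r *\<^sub>R Z) = r *\<^sub>R bc_fst Z"
  and bc_snd_scaleR [simp]: "bc_snd (r *\<^sub>R Z) = r *\<^sub>R bc_snd Z"
  by (simp_all add: scaleR_bicomplex_def)


section \<open>Idempotent representation\<close>

definition bc_of_complex :: "complex \<Rightarrow> bicomplex"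
  where "bc_of_complex z = Bicomplex z 0"

definition bc_i :: bicomplex where "bc_i = bc_of_complex \<i>"
definition bc_j :: bicomplex where "bc_j = Bicomplex 0 1"

definition e1 :: bicomplex where "e1 = (1 + bc_i * bc_j) /\<^sub>R 2"
definition e2 :: bicomplex where "e2 = (1 - bc_i * bc_j) /\<^sub>R 2"

definition bc_idem :: "complex \<Rightarrow> complex \<Rightarrow> bicomplex"
  where "bc_idem z\<^sub>1 z\<^sub>2 = e1 * bc_of_complex z\<^sub>1 + e2 * bc_of_complex z\<^sub>2"

definition idem1 :: "bicomplex \<Rightarrow> complex" where "idem1 Z = bc_fst Z - \<i> * bc_snd Z"
definition idem2 :: "bicomplex \<Rightarrow> complex" where "idem2 Z = bc_fst Z + \<i> * bc_snd Z"

lemma bicomplex_decomp: "Bicomplex z w = bc_of_complex z + bc_j * bc_of_complex w"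
  by (simp add: bicomplex_eq_iff bc_of_complex_def bc_j_def)

lemma bc_units: "bc_i * bc_i = - 1" "bc_j * bc_j = - 1"
  by (simp_all add: bicomplex_eq_iff bc_of_complex_def bc_i_def bc_j_def)

lemma e1_e2: "e1 * e1 = e1" "e2 * e2 = e2" "e1 * e2 = 0" "e1 + e2 = 1"
  by (simp_all add: bicomplex_eq_iff e1_def e2_def bc_of_complex_def bc_i_def bc_j_def
      scaleR_conv_of_real)

lemma bc_idem_components: "bc_idem z\<^sub>1 z\<^sub>2 = Bicomplex ((z\<^sub>1 + z\<^sub>2) / 2) (\<i> * (z\<^sub>1 - z\<^sub>2) / 2)"
  by (simp add: bicomplex_eq_iff bc_idem_def e1_def e2_def bc_of_complex_def bc_i_def bc_j_def
      scaleR_conv_of_real field_simps)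

lemma idem_bc_idem [simp]: "idem1 (bc_idem z\<^sub>1 z\<^sub>2) = z\<^sub>1" "idem2 (bc_idem z\<^sub>1 z\<^sub>2) = z\<^sub>2"
  by (simp_all add: bc_idem_components idem1_def idem2_def field_simps)

lemma bc_idem_idem [simp]: "bc_idem (idem1 Z) (idem2 Z) = Z"
  by (simp add: bicomplex_eq_iff bc_idem_components idem1_def idem2_def)

lemma bc_idem_eq_iff: "Z = W \<longleftrightarrow> idem1 Z = idem1 W \<and> idem2 Z = idem2 W"
  by (metis bc_idem_idem)

lemma idem_simps [simp]:
  "idem1 0 = 0" "idem2 0 = 0" "idem1 1 = 1" "idem2 1 = 1"
  "idem1 (Z + W) = idem1 Z + idem1 W" "idem2 (Z + W) = idem2 Z + idem2 W"
  "idem1 (Z - W) = idem1 Z - idem1 W" "idem2 (Z - W) = idem2 Z - idem2 W"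
  "idem1 (Z * W) = idem1 Z * idem1 W" "idem2 (Z * W) = idem2 Z * idem2 W"
  by (simp_all add: idem1_def idem2_def algebra_simps)

lemma idem_power [simp]: "idem1 (Z ^ n) = idem1 Z ^ n" "idem2 (Z ^ n) = idem2 Z ^ n"
  by (induction n) simp_all

lemma idem_sum [simp]:
  "idem1 (\<Sum>n\<in>A. a n) = (\<Sum>n\<in>A. idem1 (a n))" "idem2 (\<Sum>n\<in>A. a n) = (\<Sum>n\<in>A. idem2 (a n))"
  by (induction A rule: infinite_finite_induct) simp_all

text \<open>Componentwise quotients, with the convention \<open>x / 0 = 0\<close> in each component.\<close>

instantiation bicomplex :: inverse
begin

definition "inverse Z = bc_idem (inverse (idem1 Z)) (inverse (idem2 Z))"
definition "Z div W = bc_idem (idem1 Z / idem1 W) (idem2 Z / idem2 W)"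

instance ..

end

lemma idem_divide [simp]:
  "idem1 (Z / W) = idem1 Z / idem1 W" "idem2 (Z / W) = idem2 Z / idem2 W"
  by (simp_all add: divide_bicomplex_def)

lemma norm_bc_idem: "norm Z ^ 2 = (norm (idem1 Z) ^ 2 + norm (idem2 Z) ^ 2) / 2"
  by (simp add: norm_bicomplex_def norm_Pair idem1_def idem2_def cmod_power2)
    (simp add: power2_eq_square algebra_simps)

lemma bc_tendsto_iff:
  "(f \<longlongrightarrow> L) F \<longleftrightarrow>
     ((\<lambda>x. idem1 (f x)) \<longlongrightarrow> idem1 L) F \<and> ((\<lambda>x. idem2 (f x)) \<longlongrightarrow> idem2 L) F"
proof -
  have bound: "norm (idem1 Z) \<le> 2 * norm Z" "norm (idem2 Z) \<le> 2 * norm Z"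
    "norm Z \<le> norm (idem1 Z) + norm (idem2 Z)" for Z
  proof -
    have sq: "norm (idem1 Z) ^ 2 \<le> (2 * norm Z) ^ 2" "norm (idem2 Z) ^ 2 \<le> (2 * norm Z) ^ 2"
      by (simp_all add: power_mult_distrib norm_bc_idem add_increasing add_increasing2)
    show "norm (idem1 Z) \<le> 2 * norm Z" "norm (idem2 Z) \<le> 2 * norm Z"
      using sq by (auto intro: power2_le_imp_le)
    show "norm Z \<le> norm (idem1 Z) + norm (idem2 Z)"
    proof (rule power2_le_imp_le)
      have "norm Z ^ 2 \<le> norm (idem1 Z) ^ 2 + norm (idem2 Z) ^ 2"
        unfolding norm_bc_idem by simp
      also have "\<dots> \<le> (norm (idem1 Z) + norm (idem2 Z)) ^ 2"
        by (simp add: power2_sum)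
      finally show "norm Z ^ 2 \<le> (norm (idem1 Z) + norm (idem2 Z)) ^ 2" .
    qed simp
  qed
  have scale: "idem1 (r *\<^sub>R Z) = r *\<^sub>R idem1 Z" "idem2 (r *\<^sub>R Z) = r *\<^sub>R idem2 Z" for r Z
    by (simp_all add: idem1_def idem2_def scaleR_right_diff_distrib scaleR_right_distrib)
  have lin: "bounded_linear idem1" "bounded_linear idem2"
    by (rule bounded_linear_intro [where K = 2], simp, rule scale,
        use bound in \<open>simp add: mult.commute\<close>)+
  show ?thesis
  proof (intro iffI conjI)
    assume lim: "((\<lambda>x. idem1 (f x)) \<longlongrightarrow> idem1 L) F \<and> ((\<lambda>x. idem2 (f x)) \<longlongrightarrow> idem2 L) F"
    have "((\<lambda>x. norm (idem1 (f x) - idem1 L) + norm (idem2 (f x) - idem2 L)) \<longlongrightarrow> 0) F"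
      using lim by (intro tendsto_add_zero tendsto_norm_zero LIM_zero) auto
    moreover have "\<forall>\<^sub>F x in F. norm (f x - L)
        \<le> norm (idem1 (f x) - idem1 L) + norm (idem2 (f x) - idem2 L)"
      using bound(3) [of "f _ - L"] by (intro always_eventually allI) simp
    ultimately have "((\<lambda>x. f x - L) \<longlongrightarrow> 0) F"
      by (rule Lim_null_comparison [rotated])
    then show "(f \<longlongrightarrow> L) F" by (simp add: Lim_null [symmetric])
  next
    assume "(f \<longlongrightarrow> L) F"
    then show "((\<lambda>x. idem1 (f x)) \<longlongrightarrow> idem1 L) F" "((\<lambda>x. idem2 (f x)) \<longlongrightarrow> idem2 L) F"
      by (rule bounded_linear.tendsto [OF lin(1)], rule bounded_linear.tendsto [OF lin(2)])
  qed
qed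

lemma bc_sums_iff:
  "a sums s \<longleftrightarrow> (\<lambda>n. idem1 (a n)) sums idem1 s \<and> (\<lambda>n. idem2 (a n)) sums idem2 s"
  by (simp add: sums_def bc_tendsto_iff)

definition bc_conj3 :: "bicomplex \<Rightarrow> bicomplex"
  where "bc_conj3 Z = Bicomplex (cnj (bc_fst Z)) (- cnj (bc_snd Z))"

lemma bc_conj3_idem: "bc_conj3 Z = bc_idem (cnj (idem1 Z)) (cnj (idem2 Z))"
  by (simp add: bicomplex_eq_iff bc_conj3_def bc_idem_components idem1_def idem2_def)


section \<open>Hyperbolic numbers\<close>

definition hyp_nonneg :: "bicomplex set"
  where "hyp_nonneg = {bc_idem (complex_of_real \<alpha>\<^sub>1) (complex_of_real \<alpha>\<^sub>2) | \<alpha>\<^sub>1 \<alpha>\<^sub>2. 0 \<le> \<alpha>\<^sub>1 \<and> 0 \<le> \<alpha>\<^sub>2}"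

definition hyp_le :: "bicomplex \<Rightarrow> bicomplex \<Rightarrow> bool"
  where "hyp_le \<alpha> \<beta> \<longleftrightarrow> \<beta> - \<alpha> \<in> hyp_nonneg"

definition hyp_abs :: "bicomplex \<Rightarrow> bicomplex"
  where "hyp_abs Z = bc_idem (complex_of_real (cmod (idem1 Z))) (complex_of_real (cmod (idem2 Z)))"

text \<open>Used on \<open>hyp_nonneg\<close> only, where both components are nonnegative reals.\<close>

definition hyp_sqrt :: "bicomplex \<Rightarrow> bicomplex"
  where "hyp_sqrt Z = bc_idem (csqrt (idem1 Z)) (csqrt (idem2 Z))"

lemma hyp_sqrt:
  assumes "Z \<in> hyp_nonneg"
  shows "hyp_sqrt Z \<in> hyp_nonneg" "hyp_sqrt Z ^ 2 = Z"
  using assms by (auto simp: hyp_nonneg_def hyp_sqrt_def bc_idem_eq_iff)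


section \<open>Bicomplex holomorphic functions\<close>

definition bc_disc :: "bicomplex set"
  where "bc_disc = {bc_idem z\<^sub>1 z\<^sub>2 | z\<^sub>1 z\<^sub>2. z\<^sub>1 \<in> ball 0 1 \<and> z\<^sub>2 \<in> ball 0 1}"

text \<open>\<open>0\<close> is included, so that difference quotients are formed with invertible increments only.\<close>

definition bc_zero_divisors :: "bicomplex set"
  where "bc_zero_divisors = {Z. \<exists>W. W \<noteq> 0 \<and> Z * W = 0}"

lemma bc_zero_divisors_iff: "Z \<in> bc_zero_divisors \<longleftrightarrow> idem1 Z = 0 \<or> idem2 Z = 0"
proof
  show "Z \<in> bc_zero_divisors \<Longrightarrow> idem1 Z = 0 \<or> idem2 Z = 0"
    by (auto simp: bc_zero_divisors_def bc_idem_eq_iff)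
next
  assume "idem1 Z = 0 \<or> idem2 Z = 0"
  then have "Z * bc_idem 1 0 = 0 \<or> Z * bc_idem 0 1 = 0"
    by (auto simp: bc_idem_eq_iff)
  moreover have "bc_idem 1 0 \<noteq> 0" "bc_idem 0 1 \<noteq> 0"
    by (simp_all add: bc_idem_eq_iff)
  ultimately show "Z \<in> bc_zero_divisors"
    by (auto simp: bc_zero_divisors_def)
qed

definition has_bc_derivative :: "(bicomplex \<Rightarrow> bicomplex) \<Rightarrow> bicomplex \<Rightarrow> bicomplex \<Rightarrow> bool"
  where "has_bc_derivative f D Z \<longleftrightarrow>
    ((\<lambda>H. (f (Z + H) - f Z) / H) \<longlongrightarrow> D) (at 0 within - bc_zero_divisors)"

text \<open>For open \<open>S\<close>, as here, the values of \<open>f\<close> outside \<open>S\<close> are irrelevant.\<close>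

definition bc_holomorphic_on :: "(bicomplex \<Rightarrow> bicomplex) \<Rightarrow> bicomplex set \<Rightarrow> bool"
  where "bc_holomorphic_on f S \<longleftrightarrow> (\<forall>Z\<in>S. \<exists>D. has_bc_derivative f D Z)"


section \<open>Bicomplex weighted Hardy spaces\<close>

definition sq_summable :: "(nat \<Rightarrow> bicomplex) \<Rightarrow> (nat \<Rightarrow> bicomplex) \<Rightarrow> bool"
  where "sq_summable \<beta> a \<longleftrightarrow> summable (\<lambda>n. hyp_abs (a n) ^ 2 * \<beta> n ^ 2)"

definition hardy_weight :: "(nat \<Rightarrow> bicomplex) \<Rightarrow> bool"
  where "hardy_weight \<beta> \<longleftrightarrow>
    (\<forall>n. \<exists>\<beta>\<^sub>1 \<beta>\<^sub>2. 0 < \<beta>\<^sub>1 \<and> 0 < \<beta>\<^sub>2 \<and> \<beta> n = bc_idem (complex_of_real \<beta>\<^sub>1) (complex_of_real \<beta>\<^sub>2)) \<and>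
    (\<forall>a. sq_summable \<beta> a \<longrightarrow>
      (\<forall>Z\<in>bc_disc. summable (\<lambda>n. a n * Z ^ n)) \<and>
      bc_holomorphic_on (\<lambda>Z. \<Sum>n. a n * Z ^ n) bc_disc)"

text \<open>A function on \<open>bc_disc\<close> is represented by a total function whose values elsewhere are
  arbitrary: membership, coefficients, inner product and norm depend only on the restriction
  to \<open>bc_disc\<close>.\<close>

definition has_bc_power_series :: "(bicomplex \<Rightarrow> bicomplex) \<Rightarrow> (nat \<Rightarrow> bicomplex) \<Rightarrow> bool"
  where "has_bc_power_series f a \<longleftrightarrow> (\<forall>Z\<in>bc_disc. (\<lambda>n. a n * Z ^ n) sums f Z)"

lemma has_bc_power_series_unique:
  assumes "has_bc_power_series f a" "has_bc_power_series f b"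
  shows "a = b"
proof -
  have uniq: "u = v"
    if u: "\<And>z. norm z < 1 \<Longrightarrow> (\<lambda>n. u n * z ^ n) sums g z"
      and v: "\<And>z. norm z < 1 \<Longrightarrow> (\<lambda>n. v n * z ^ n) sums g z"
    for u v :: "nat \<Rightarrow> complex" and g
  proof (rule ccontr)
    assume "u \<noteq> v"
    then obtain m where m: "u m - v m \<noteq> 0" by auto
    have s: "(\<lambda>n. (u n - v n) * (z - 0) ^ n) sums 0" if "norm (z - 0) < 1" for z
      using sums_diff [OF u v, of z z] that by (simp add: algebra_simps)
    have z0: "u 0 - v 0 = 0"
      using sums_unique2 [OF powser_sums_zero [of "\<lambda>n. u n - v n"]] s [of 0] by simp
    have "m > 0" using m z0 by (cases m) auto
    show False
    proof (rule powser_0_nonzero [of 1 0 "\<lambda>n. u n - v n" "\<lambda>_. 0" m])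
      fix r :: real
      assume r: "0 < r" "\<And>z :: complex. z \<in> cball 0 r - {0} \<Longrightarrow> (0 :: complex) \<noteq> 0"
      show False using r(2) [of "complex_of_real r"] r(1) by simp
    qed (use s m \<open>m > 0\<close> in auto)
  qed
  have comp: "(\<lambda>n. idem1 (c n) * z ^ n) sums idem1 (f (bc_idem z 0))"
             "(\<lambda>n. idem2 (c n) * z ^ n) sums idem2 (f (bc_idem 0 z))"
    if c: "has_bc_power_series f c" and z: "norm z < 1" for c z
  proof -
    have "bc_idem z 0 \<in> bc_disc" "bc_idem 0 z \<in> bc_disc"
      unfolding bc_disc_def mem_Collect_eq using z by (metis mem_ball_0 norm_zero zero_less_one)+
    then have "(\<lambda>n. c n * bc_idem z 0 ^ n) sums f (bc_idem z 0)"
              "(\<lambda>n. c n * bc_idem 0 z ^ n) sums f (bc_idem 0 z)"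
      using c by (auto simp only: has_bc_power_series_def)
    then show "(\<lambda>n. idem1 (c n) * z ^ n) sums idem1 (f (bc_idem z 0))"
              "(\<lambda>n. idem2 (c n) * z ^ n) sums idem2 (f (bc_idem 0 z))"
      unfolding bc_sums_iff idem_simps idem_power idem_bc_idem by blast+
  qed
  have "(\<lambda>n. idem1 (a n)) = (\<lambda>n. idem1 (b n))" "(\<lambda>n. idem2 (a n)) = (\<lambda>n. idem2 (b n))"
    by (rule uniq; (rule comp [OF assms(1)] comp [OF assms(2)]; assumption))+
  then have "a n = b n" for n
    by (metis bc_idem_idem)
  then show ?thesis by (rule ext)
qed

definition bc_coeffs :: "(bicomplex \<Rightarrow> bicomplex) \<Rightarrow> nat \<Rightarrow> bicomplex"
  where "bc_coeffs f = (THE a. has_bc_power_series f a)"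

lemma bc_coeffs_eq: "has_bc_power_series f a \<Longrightarrow> bc_coeffs f = a"
  unfolding bc_coeffs_def using has_bc_power_series_unique by blast

definition H2 :: "(nat \<Rightarrow> bicomplex) \<Rightarrow> (bicomplex \<Rightarrow> bicomplex) set"
  where "H2 \<beta> = {f. \<exists>a. sq_summable \<beta> a \<and> has_bc_power_series f a}"

definition H2_inner ::
    "(nat \<Rightarrow> bicomplex) \<Rightarrow> (bicomplex \<Rightarrow> bicomplex) \<Rightarrow> (bicomplex \<Rightarrow> bicomplex) \<Rightarrow> bicomplex"
  where "H2_inner \<beta> f g = (\<Sum>n. bc_coeffs f n * bc_conj3 (bc_coeffs g n) * \<beta> n ^ 2)"

definition H2_norm :: "(nat \<Rightarrow> bicomplex) \<Rightarrow> (bicomplex \<Rightarrow> bicomplex) \<Rightarrow> bicomplex"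
  where "H2_norm \<beta> f = hyp_sqrt (H2_inner \<beta> f f)"

definition H2_gen :: "(nat \<Rightarrow> bicomplex) \<Rightarrow> bicomplex \<Rightarrow> bicomplex"
  where "H2_gen \<beta> Z = (\<Sum>n. Z ^ n / \<beta> n ^ 2)"

definition H2_kernel :: "(nat \<Rightarrow> bicomplex) \<Rightarrow> bicomplex \<Rightarrow> bicomplex \<Rightarrow> bicomplex"
  where "H2_kernel \<beta> W Z = H2_gen \<beta> (bc_conj3 W * Z)"


section \<open>Linear functionals\<close>

text \<open>The domain of a linear functional is a module over the bicomplex numbers, with pointwise
  operations; this is part of the definition.\<close>

definition bc_submodule :: "(bicomplex \<Rightarrow> bicomplex) set \<Rightarrow> bool"
  where "bc_submodule V \<longleftrightarrow> (\<lambda>Z. 0) \<in> V \<and>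
    (\<forall>f\<in>V. \<forall>g\<in>V. (\<lambda>Z. f Z + g Z) \<in> V) \<and>
    (\<forall>c. \<forall>f\<in>V. (\<lambda>Z. c * f Z) \<in> V)"

definition bc_linear_functional_on ::
    "(bicomplex \<Rightarrow> bicomplex) set \<Rightarrow> ((bicomplex \<Rightarrow> bicomplex) \<Rightarrow> bicomplex) \<Rightarrow> bool"
  where "bc_linear_functional_on V E \<longleftrightarrow> bc_submodule V \<and>
    (\<forall>f\<in>V. \<forall>g\<in>V. E (\<lambda>Z. f Z + g Z) = E f + E g) \<and>
    (\<forall>c. \<forall>f\<in>V. E (\<lambda>Z. c * f Z) = c * E f)"

definition H2_bounded ::
    "(nat \<Rightarrow> bicomplex) \<Rightarrow> ((bicomplex \<Rightarrow> bicomplex) \<Rightarrow> bicomplex) \<Rightarrow> bool"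
  where "H2_bounded \<beta> E \<longleftrightarrow>
    (\<exists>M\<in>hyp_nonneg. \<forall>f\<in>H2 \<beta>. hyp_le (hyp_abs (E f)) (M * H2_norm \<beta> f))"

end

theory Submission
  imports Defs
begin

text \<open>Everything splits along the idempotents into two scalar weighted Hardy spaces. In each of
  them the only analytic point is that \<open>\<Sum> \<bar>w\<bar>\<^sup>2\<^sup>n / b\<^sub>n\<^sup>2\<close> converges for \<open>\<bar>w\<bar> < 1\<close>, i.e. that the
  kernel lies in the space; no growth condition on the weight is assumed, only that square-summable
  coefficients give convergent series. If \<open>r\<^sup>n / b\<^sub>n\<close> were unbounded for some \<open>r < 1\<close>, the
  coefficients \<open>r\<^sup>-\<^sup>n\<close> along a sparse subsequence would be square-summable, although the resulting
  series has infinitely many terms equal to 1 at \<open>r\<close>. Hence \<open>r\<^sup>n / b\<^sub>n\<close> is bounded for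
  \<open>\<bar>w\<bar> < r < 1\<close>, and one compares with a geometric series. The reproducing formula is then
  a termwise identity, and boundedness is the Cauchy--Schwarz inequality.\<close>

section \<open>Scalar weighted sequences\<close>

text \<open>A finite initial segment has a maximum, so \<open>c\<close> stays unbounded beyond every
  index and \<open>g\<close> can be chosen recursively. The rate \<open>2 ^ k\<close> makes the
  squared reciprocals along \<open>g\<close> summable.\<close>

lemma unbounded_subsequence:
  fixes c :: "nat \<Rightarrow> real"
  assumes "\<not> (\<exists>B. \<forall>n. c n \<le> B)"
  obtains g :: "nat \<Rightarrow> nat" where "strict_mono g" "\<And>k. 2 ^ k < c (g k)"
proof -
  have ex: "\<exists>n>N. B < c n" for N B
  proof (rule ccontr)
    assume "\<not> (\<exists>n>N. B < c n)"
    then have "c n \<le> B" if "N < n" for n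
      using that not_less by blast
    then have "c n \<le> max B (Max (c ` {..N}))" for n
      by (cases "n \<le> N") (simp_all add: max.coboundedI1 max.coboundedI2)
    with assms show False by blast
  qed
  have "\<exists>g. \<forall>k. 2 ^ k < c (g k) \<and> g k < g (Suc k)"
    by (rule dependent_nat_choice) (use ex in blast)+
  then show thesis
    using that by (auto simp: strict_mono_Suc_iff)
qed

lemma weight_ratio_bounded:
  fixes b :: "nat \<Rightarrow> real" and r :: real
  assumes pos: "\<And>n. 0 < b n"
    and adm: "\<And>u :: nat \<Rightarrow> complex. summable (\<lambda>n. (cmod (u n))\<^sup>2 * (b n)\<^sup>2) \<Longrightarrow>
      summable (\<lambda>n. u n * of_real r ^ n)"
    and r: "0 < r"
  shows "\<exists>B. \<forall>n. r ^ n / b n \<le> B"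
proof (rule ccontr)
  assume "\<not> ?thesis"
  then obtain g where g: "strict_mono g" "\<And>k. 2 ^ k < r ^ g k / b (g k)"
    by (rule unbounded_subsequence) blast
  \<comment> \<open>Normalised so that \<open>u n * r ^ n\<close> is 1 along \<open>g\<close>, which
    prevents these terms from tending to 0.\<close>
  define u where "u n = (if n \<in> range g then 1 / complex_of_real r ^ n else 0)" for n
  have val: "(cmod (u (g k)))\<^sup>2 * (b (g k))\<^sup>2 = (b (g k) / r ^ g k)\<^sup>2" for k
    using r by (simp add: u_def norm_divide norm_power power_divide)
  have "summable (\<lambda>k. (cmod (u (g k)))\<^sup>2 * (b (g k))\<^sup>2)"
  proof (rule summable_comparison_test')
    show "summable (\<lambda>k. (1 / 4 :: real) ^ k)" by (rule summable_geometric) simp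
  next
    fix k :: nat
    have "b (g k) / r ^ g k \<le> 1 / 2 ^ k"
      using g(2)[of k] pos[of "g k"] r by (simp add: field_simps)
    then have "(b (g k) / r ^ g k)\<^sup>2 \<le> (1 / 2 ^ k)\<^sup>2"
      using pos[of "g k"] r by (intro power_mono) (auto intro: less_imp_le)
    also have "\<dots> = (1 / 4) ^ k"
      by (simp add: power_divide power2_eq_square flip: power_mult_distrib)
    finally show "norm ((cmod (u (g k)))\<^sup>2 * (b (g k))\<^sup>2) \<le> (1 / 4) ^ k"
      unfolding val by simp
  qed
  \<comment> \<open>Since \<open>u\<close> vanishes off the range of \<open>g\<close>, summability
    along \<open>g\<close> is summability over all indices.\<close>
  then have "summable (\<lambda>n. (cmod (u n))\<^sup>2 * (b n)\<^sup>2)"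
    by (subst (asm) summable_mono_reindex[OF g(1)]) (auto simp: u_def)
  then have "(\<lambda>n. u n * of_real r ^ n) \<longlonglongrightarrow> 0"
    by (intro summable_LIMSEQ_zero adm)
  then have "((\<lambda>n. u n * of_real r ^ n) \<circ> g) \<longlonglongrightarrow> 0"
    using g(1) by (rule LIMSEQ_subseq_LIMSEQ)
  moreover have "((\<lambda>n. u n * of_real r ^ n) \<circ> g) = (\<lambda>_. 1)"
    using r by (auto simp: u_def fun_eq_iff)
  ultimately show False
    by (simp add: LIMSEQ_const_iff)
qed

lemma kernel_summable:
  fixes b :: "nat \<Rightarrow> real" and w :: complex
  assumes pos: "\<And>n. 0 < b n"
    and adm: "\<And>(u :: nat \<Rightarrow> complex) z. summable (\<lambda>n. (cmod (u n))\<^sup>2 * (b n)\<^sup>2) \<Longrightarrow>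
      norm z < 1 \<Longrightarrow> summable (\<lambda>n. u n * z ^ n)"
    and w: "norm w < 1"
  shows "summable (\<lambda>n. (cmod w ^ n / b n)\<^sup>2)"
proof -
  \<comment> \<open>The gap between \<open>cmod w\<close> and \<open>r\<close> supplies geometric
    decay with ratio \<open>cmod w / r\<close>; the bounded ratio \<open>r ^ n / b n\<close> absorbs
    the weight.\<close>
  obtain r where r: "cmod w < r" "r < 1"
    using w dense by blast
  have r0: "0 < r" using r(1) norm_ge_zero[of w] by linarith
  obtain B where B: "\<And>n. r ^ n / b n \<le> B"
    using weight_ratio_bounded[where b = b, OF pos adm r0] r r0 by auto
  define q where "q = cmod w / r"
  have q: "0 \<le> q" "q < 1" using r r0 by (auto simp: q_def)
  have "summable (\<lambda>n. B\<^sup>2 * (q\<^sup>2) ^ n)"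
    using q by (intro summable_mult summable_geometric) (simp add: power_less_one_iff abs_square_less_1)
  then show ?thesis
  proof (rule summable_comparison_test')
    fix n
    have "cmod w ^ n / b n = (r ^ n / b n) * q ^ n"
      using r0 by (simp add: q_def power_divide)
    then have "(cmod w ^ n / b n)\<^sup>2 = (r ^ n / b n)\<^sup>2 * (q ^ n)\<^sup>2"
      by (simp only: power_mult_distrib)
    also have "\<dots> \<le> B\<^sup>2 * (q ^ n)\<^sup>2"
      using B[of n] r0 pos[of n] by (intro mult_right_mono power_mono) (auto intro: less_imp_le)
    finally show "norm ((cmod w ^ n / b n)\<^sup>2) \<le> B\<^sup>2 * (q\<^sup>2) ^ n"
      by (simp add: mult.commute flip: power_mult)
  qed
qed

text \<open>Splitting \<open>u n * w ^ n\<close> into the factors \<open>w ^ n / b n\<close> and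
  \<open>u n * b n\<close>, the finite Cauchy-Schwarz inequality bounds all partial sums uniformly,
  and the bound passes to the limit \<open>s\<close>.\<close>

lemma weighted_Cauchy_Schwarz:
  fixes b :: "nat \<Rightarrow> real" and u :: "nat \<Rightarrow> complex"
  assumes pos: "\<And>n. 0 < b n"
    and u: "summable (\<lambda>n. (cmod (u n))\<^sup>2 * (b n)\<^sup>2)"
    and w: "summable (\<lambda>n. (cmod w ^ n / b n)\<^sup>2)"
    and s: "(\<lambda>n. u n * w ^ n) sums s"
  shows "cmod s \<le> sqrt (\<Sum>n. (cmod w ^ n / b n)\<^sup>2) * sqrt (\<Sum>n. (cmod (u n))\<^sup>2 * (b n)\<^sup>2)"
proof (rule LIMSEQ_le_const2)
  show "(\<lambda>N. cmod (\<Sum>n<N. u n * w ^ n)) \<longlonglongrightarrow> cmod s"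
    using s unfolding sums_def by (rule tendsto_norm)
  have "cmod (\<Sum>n<N. u n * w ^ n) \<le>
      sqrt (\<Sum>n. (cmod w ^ n / b n)\<^sup>2) * sqrt (\<Sum>n. (cmod (u n))\<^sup>2 * (b n)\<^sup>2)" for N
  proof -
    have "cmod (\<Sum>n<N. u n * w ^ n) \<le> (\<Sum>n<N. \<bar>cmod w ^ n / b n\<bar> * \<bar>cmod (u n) * b n\<bar>)"
      using pos
      by (intro sum_norm_le) (simp add: norm_mult norm_power abs_mult less_imp_neq[OF pos, symmetric])
    also have "\<dots> \<le> sqrt (\<Sum>n<N. (cmod w ^ n / b n)\<^sup>2) * sqrt (\<Sum>n<N. (cmod (u n) * b n)\<^sup>2)"
      using L2_set_mult_ineq[of "\<lambda>n. cmod w ^ n / b n" "\<lambda>n. cmod (u n) * b n" "{..<N}"]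
      by (simp only: L2_set_def)
    also have "\<dots> \<le> sqrt (\<Sum>n. (cmod w ^ n / b n)\<^sup>2) * sqrt (\<Sum>n. (cmod (u n))\<^sup>2 * (b n)\<^sup>2)"
      unfolding power_mult_distrib
      using u w by (intro mult_mono real_sqrt_le_mono sum_le_suminf) (auto intro: sum_nonneg suminf_nonneg)
    finally show ?thesis .
  qed
  then show "\<exists>N0. \<forall>N\<ge>N0. cmod (\<Sum>n<N. u n * w ^ n) \<le>
      sqrt (\<Sum>n. (cmod w ^ n / b n)\<^sup>2) * sqrt (\<Sum>n. (cmod (u n))\<^sup>2 * (b n)\<^sup>2)"
    by blast
qed

section \<open>Passage to idempotent components\<close>

lemma bc_summable_iff:
  "summable a \<longleftrightarrow> summable (\<lambda>n. idem1 (a n)) \<and> summable (\<lambda>n. idem2 (a n))"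
proof
  show "summable a \<Longrightarrow> summable (\<lambda>n. idem1 (a n)) \<and> summable (\<lambda>n. idem2 (a n))"
    by (auto simp: summable_def bc_sums_iff)
next
  assume "summable (\<lambda>n. idem1 (a n)) \<and> summable (\<lambda>n. idem2 (a n))"
  then obtain s t where "(\<lambda>n. idem1 (a n)) sums s" "(\<lambda>n. idem2 (a n)) sums t"
    by (auto simp: summable_def)
  then have "a sums bc_idem s t" by (simp add: bc_sums_iff)
  then show "summable a" by (rule sums_summable)
qed

lemma bc_disc_iff: "Z \<in> bc_disc \<longleftrightarrow> cmod (idem1 Z) < 1 \<and> cmod (idem2 Z) < 1"
proof
  show "Z \<in> bc_disc \<Longrightarrow> cmod (idem1 Z) < 1 \<and> cmod (idem2 Z) < 1"
    by (auto simp: bc_disc_def)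
  assume "cmod (idem1 Z) < 1 \<and> cmod (idem2 Z) < 1"
  then show "Z \<in> bc_disc"
    unfolding bc_disc_def mem_Collect_eq by (metis bc_idem_idem mem_ball_0)
qed

text \<open>Both \<open>hyp_abs (a n)\<close> and \<open>\<beta> n\<close> have real components,
  which yields two real conditions in the form that the scalar lemmas take.\<close>

lemma sq_summable_iff:
  assumes "\<And>n. \<beta> n = bc_idem (complex_of_real (b1 n)) (complex_of_real (b2 n))"
  shows "sq_summable \<beta> a \<longleftrightarrow>
    summable (\<lambda>n. (cmod (idem1 (a n)))\<^sup>2 * (b1 n)\<^sup>2) \<and>
    summable (\<lambda>n. (cmod (idem2 (a n)))\<^sup>2 * (b2 n)\<^sup>2)"
  unfolding sq_summable_def bc_summable_iff
  by (simp add: assms hyp_abs_def flip: of_real_power of_real_mult)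

text \<open>Comparison through \<open>2 * x * y \<le> x^2 + y^2\<close>; this gives closure of the
  Hardy space under addition.\<close>

lemma summable_weighted_square_add:
  fixes u v :: "nat \<Rightarrow> complex" and b :: "nat \<Rightarrow> real"
  assumes "summable (\<lambda>n. (cmod (u n))\<^sup>2 * (b n)\<^sup>2)" "summable (\<lambda>n. (cmod (v n))\<^sup>2 * (b n)\<^sup>2)"
  shows "summable (\<lambda>n. (cmod (u n + v n))\<^sup>2 * (b n)\<^sup>2)"
proof (rule summable_comparison_test')
  show "summable (\<lambda>n. 2 * ((cmod (u n))\<^sup>2 * (b n)\<^sup>2 + (cmod (v n))\<^sup>2 * (b n)\<^sup>2))"
    using assms by (intro summable_mult summable_add)
next
  fix n
  have "(cmod (u n + v n))\<^sup>2 \<le> (cmod (u n) + cmod (v n))\<^sup>2"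
    by (intro power_mono norm_triangle_ineq) simp
  also have "\<dots> \<le> 2 * ((cmod (u n))\<^sup>2 + (cmod (v n))\<^sup>2)"
    using sum_squares_bound[of "cmod (u n)" "cmod (v n)"] by (simp add: power2_sum)
  finally have "(cmod (u n + v n))\<^sup>2 * (b n)\<^sup>2 \<le> 2 * ((cmod (u n))\<^sup>2 + (cmod (v n))\<^sup>2) * (b n)\<^sup>2"
    by (rule mult_right_mono) simp
  then show "norm ((cmod (u n + v n))\<^sup>2 * (b n)\<^sup>2)
      \<le> 2 * ((cmod (u n))\<^sup>2 * (b n)\<^sup>2 + (cmod (v n))\<^sup>2 * (b n)\<^sup>2)"
    by (simp add: algebra_simps)
qed

lemma hardy_weightE:
  assumes "hardy_weight \<beta>"
  obtains b1 b2 where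
    "\<And>n. \<beta> n = bc_idem (complex_of_real (b1 n)) (complex_of_real (b2 n))"
    "\<And>n. 0 < b1 n" "\<And>n. 0 < b2 n"
proof -
  \<comment> \<open>Packing both weights into a pair lets a single choice function produce both
    sequences.\<close>
  have "\<forall>n. \<exists>p. 0 < fst p \<and> 0 < snd p \<and> \<beta> n = bc_idem (complex_of_real (fst p)) (complex_of_real (snd p))"
    using assms unfolding hardy_weight_def by auto
  then obtain p where
    "\<forall>n. 0 < fst (p n) \<and> 0 < snd (p n) \<and>
      \<beta> n = bc_idem (complex_of_real (fst (p n))) (complex_of_real (snd (p n)))"
    by metis
  then show thesis
    using that[of "\<lambda>n. fst (p n)" "\<lambda>n. snd (p n)"] by blast
qed

lemma hardy_weight_summable:
  "hardy_weight \<beta> \<Longrightarrow> sq_summable \<beta> a \<Longrightarrow> Z \<in> bc_disc \<Longrightarrow> summable (\<lambda>n. a n * Z ^ n)"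
  by (simp add: hardy_weight_def)

text \<open>A scalar sequence and a scalar point are placed in one idempotent slot, with 0 in the
  other. The zero slot is square-summable and lies in the disc, so the bicomplex admissibility of
  \<open>\<beta>\<close> specialises to each scalar weight.\<close>

lemma hardy_kernel_summable:
  assumes hw: "hardy_weight \<beta>"
    and \<beta>: "\<And>n. \<beta> n = bc_idem (complex_of_real (b1 n)) (complex_of_real (b2 n))"
    and pos: "\<And>n. 0 < b1 n" "\<And>n. 0 < b2 n"
    and W: "W \<in> bc_disc"
  shows "summable (\<lambda>n. (cmod (idem1 W) ^ n / b1 n)\<^sup>2)"
    and "summable (\<lambda>n. (cmod (idem2 W) ^ n / b2 n)\<^sup>2)"
proof -
  have "summable (\<lambda>n. u n * z ^ n)"
    if "summable (\<lambda>n. (cmod (u n))\<^sup>2 * (b1 n)\<^sup>2)" "norm z < 1" for u :: "nat \<Rightarrow> complex" and z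
    using hardy_weight_summable[OF hw, of "\<lambda>n. bc_idem (u n) 0" "bc_idem z 0"] that
    by (simp add: sq_summable_iff[OF \<beta>] bc_disc_iff bc_summable_iff)
  then show "summable (\<lambda>n. (cmod (idem1 W) ^ n / b1 n)\<^sup>2)"
    using pos W by (intro kernel_summable) (auto simp: bc_disc_iff)
  have "summable (\<lambda>n. u n * z ^ n)"
    if "summable (\<lambda>n. (cmod (u n))\<^sup>2 * (b2 n)\<^sup>2)" "norm z < 1" for u :: "nat \<Rightarrow> complex" and z
    using hardy_weight_summable[OF hw, of "\<lambda>n. bc_idem 0 (u n)" "bc_idem 0 z"] that
    by (simp add: sq_summable_iff[OF \<beta>] bc_disc_iff bc_summable_iff)
  then show "summable (\<lambda>n. (cmod (idem2 W) ^ n / b2 n)\<^sup>2)"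
    using pos W by (intro kernel_summable) (auto simp: bc_disc_iff)
qed

section \<open>Module structure and norm of the Hardy space\<close>

lemma H2E:
  assumes "f \<in> H2 \<beta>"
  obtains a where "sq_summable \<beta> a" "has_bc_power_series f a" "bc_coeffs f = a"
  using assms bc_coeffs_eq unfolding H2_def by blast

lemma bc_submodule_H2:
  assumes \<beta>: "\<And>n. \<beta> n = bc_idem (complex_of_real (b1 n)) (complex_of_real (b2 n))"
  shows "bc_submodule (H2 \<beta>)"
  unfolding bc_submodule_def
proof (intro conjI ballI allI)
  have "sq_summable \<beta> (\<lambda>_. 0)" by (simp add: sq_summable_iff[OF \<beta>])
  moreover have "has_bc_power_series (\<lambda>_. 0) (\<lambda>_. 0)" by (simp add: has_bc_power_series_def)
  ultimately show "(\<lambda>Z. 0) \<in> H2 \<beta>" unfolding H2_def by blast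
next
  fix f g assume "f \<in> H2 \<beta>" "g \<in> H2 \<beta>"
  then obtain a c where ac: "sq_summable \<beta> a" "has_bc_power_series f a"
      "sq_summable \<beta> c" "has_bc_power_series g c"
    unfolding H2_def by blast
  have "sq_summable \<beta> (\<lambda>n. a n + c n)"
    using ac(1,3) unfolding sq_summable_iff[OF \<beta>]
    by (auto intro: summable_weighted_square_add)
  moreover have "has_bc_power_series (\<lambda>Z. f Z + g Z) (\<lambda>n. a n + c n)"
    using ac(2,4) unfolding has_bc_power_series_def
    by (auto simp: distrib_right intro: sums_add)
  ultimately show "(\<lambda>Z. f Z + g Z) \<in> H2 \<beta>" unfolding H2_def by blast
next
  fix k f assume "f \<in> H2 \<beta>"
  then obtain a where a: "sq_summable \<beta> a" "has_bc_power_series f a"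
    unfolding H2_def by blast
  have "sq_summable \<beta> (\<lambda>n. k * a n)"
    using a(1) unfolding sq_summable_iff[OF \<beta>]
    by (auto simp: norm_mult power_mult_distrib mult.assoc intro: summable_mult)
  moreover have "has_bc_power_series (\<lambda>Z. k * f Z) (\<lambda>n. k * a n)"
    using a(2) unfolding has_bc_power_series_def bc_sums_iff
    by (auto simp: mult.assoc intro: sums_mult)
  ultimately show "(\<lambda>Z. k * f Z) \<in> H2 \<beta>" unfolding H2_def by blast
qed

text \<open>The components of \<open>H2_inner \<beta> f f\<close> are sums of nonnegative reals,
  where the complex square root in \<open>hyp_sqrt\<close> agrees with the real one.\<close>

lemma H2_norm_eq:
  assumes \<beta>: "\<And>n. \<beta> n = bc_idem (complex_of_real (b1 n)) (complex_of_real (b2 n))"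
    and a: "sq_summable \<beta> a" "bc_coeffs f = a"
  shows "H2_norm \<beta> f = bc_idem
    (complex_of_real (sqrt (\<Sum>n. (cmod (idem1 (a n)))\<^sup>2 * (b1 n)\<^sup>2)))
    (complex_of_real (sqrt (\<Sum>n. (cmod (idem2 (a n)))\<^sup>2 * (b2 n)\<^sup>2)))"
    (is "_ = bc_idem (of_real (sqrt ?A1)) (of_real (sqrt ?A2))")
proof -
  have s: "summable (\<lambda>n. (cmod (idem1 (a n)))\<^sup>2 * (b1 n)\<^sup>2)"
      "summable (\<lambda>n. (cmod (idem2 (a n)))\<^sup>2 * (b2 n)\<^sup>2)"
    using a(1) by (simp_all add: sq_summable_iff[OF \<beta>])
  have "(\<lambda>n. a n * bc_conj3 (a n) * \<beta> n ^ 2) sums bc_idem (of_real ?A1) (of_real ?A2)"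
    using s unfolding bc_sums_iff
    by (simp add: \<beta> bc_conj3_idem complex_norm_square[symmetric] sums_of_real_iff summable_sums
      flip: of_real_power of_real_mult)
  then have "H2_inner \<beta> f f = bc_idem (of_real ?A1) (of_real ?A2)"
    unfolding H2_inner_def a(2) by (rule sums_unique[symmetric])
  moreover have "0 \<le> ?A1" "0 \<le> ?A2" using s by (auto intro: suminf_nonneg)
  ultimately show ?thesis
    by (simp add: H2_norm_def hyp_sqrt_def csqrt_of_real_nonneg)
qed

section \<open>Point evaluation and the reproducing kernel\<close>

lemma H2_bounded_eval:
  assumes "hardy_weight \<beta>" and W: "W \<in> bc_disc"
  shows "H2_bounded \<beta> (\<lambda>f. f W)"
proof -
  obtain b1 b2 where \<beta>: "\<And>n. \<beta> n = bc_idem (complex_of_real (b1 n)) (complex_of_real (b2 n))"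
    and pos: "\<And>n. 0 < b1 n" "\<And>n. 0 < b2 n"
    using assms(1) by (rule hardy_weightE) blast
  note ker = hardy_kernel_summable[OF assms(1) \<beta> pos W]
  let ?K1 = "\<Sum>n. (cmod (idem1 W) ^ n / b1 n)\<^sup>2" and ?K2 = "\<Sum>n. (cmod (idem2 W) ^ n / b2 n)\<^sup>2"
  \<comment> \<open>The two Cauchy-Schwarz constants; they are the components of the hyperbolic norm
    of the kernel at \<open>W\<close>.\<close>
  define M where "M = bc_idem (complex_of_real (sqrt ?K1)) (complex_of_real (sqrt ?K2))"
  have "0 \<le> ?K1" "0 \<le> ?K2" using ker by (auto intro: suminf_nonneg)
  then have "M \<in> hyp_nonneg"
    unfolding hyp_nonneg_def M_def mem_Collect_eq by (metis real_sqrt_ge_zero)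
  moreover have "hyp_le (hyp_abs (f W)) (M * H2_norm \<beta> f)" if f: "f \<in> H2 \<beta>" for f
  proof -
    obtain a where a: "sq_summable \<beta> a" "has_bc_power_series f a" "bc_coeffs f = a"
      using f by (rule H2E) blast
    let ?A1 = "\<Sum>n. (cmod (idem1 (a n)))\<^sup>2 * (b1 n)\<^sup>2"
      and ?A2 = "\<Sum>n. (cmod (idem2 (a n)))\<^sup>2 * (b2 n)\<^sup>2"
    have "(\<lambda>n. a n * W ^ n) sums f W" using a(2) W by (simp add: has_bc_power_series_def)
    then have s: "(\<lambda>n. idem1 (a n) * idem1 W ^ n) sums idem1 (f W)"
        "(\<lambda>n. idem2 (a n) * idem2 W ^ n) sums idem2 (f W)"
      by (simp_all add: bc_sums_iff)
    have le: "cmod (idem1 (f W)) \<le> sqrt ?K1 * sqrt ?A1" "cmod (idem2 (f W)) \<le> sqrt ?K2 * sqrt ?A2"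
      using a(1) ker s pos by (auto simp: sq_summable_iff[OF \<beta>] intro!: weighted_Cauchy_Schwarz)
    have "M * H2_norm \<beta> f - hyp_abs (f W) =
        bc_idem (complex_of_real (sqrt ?K1 * sqrt ?A1 - cmod (idem1 (f W))))
          (complex_of_real (sqrt ?K2 * sqrt ?A2 - cmod (idem2 (f W))))"
      by (simp add: bc_idem_eq_iff M_def H2_norm_eq[OF \<beta> a(1,3)] hyp_abs_def)
    then show ?thesis
      using le unfolding hyp_le_def hyp_nonneg_def mem_Collect_eq
      by (intro exI conjI) (assumption | simp only: diff_ge_0_iff_ge)+
  qed
  ultimately show ?thesis unfolding H2_bounded_def by blast
qed

text \<open>In each component the weighted square of the coefficient is
  \<open>(cmod w ^ n / b n)^2\<close>, summable by \<open>hardy_kernel_summable\<close>.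
  Admissibility of \<open>\<beta>\<close> then makes the series defining the kernel converge on the
  whole disc, so its \<open>suminf\<close> is a genuine sum.\<close>

lemma H2_kernel_power_series:
  assumes "hardy_weight \<beta>" and W: "W \<in> bc_disc"
  shows "sq_summable \<beta> (\<lambda>n. bc_conj3 W ^ n / \<beta> n ^ 2)"
    and "has_bc_power_series (H2_kernel \<beta> W) (\<lambda>n. bc_conj3 W ^ n / \<beta> n ^ 2)"
proof -
  obtain b1 b2 where \<beta>: "\<And>n. \<beta> n = bc_idem (complex_of_real (b1 n)) (complex_of_real (b2 n))"
    and pos: "\<And>n. 0 < b1 n" "\<And>n. 0 < b2 n"
    using assms(1) by (rule hardy_weightE) blast
  have "(x / t\<^sup>2)\<^sup>2 * t\<^sup>2 = (x / t)\<^sup>2" if "0 < t" for x t :: real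
    using that by (simp add: field_simps power2_eq_square)
  then show sq: "sq_summable \<beta> (\<lambda>n. bc_conj3 W ^ n / \<beta> n ^ 2)"
    using hardy_kernel_summable[OF assms(1) \<beta> pos W] pos
    by (simp add: sq_summable_iff[OF \<beta>] \<beta> bc_conj3_idem norm_divide norm_power)
  have "bc_conj3 W ^ n / \<beta> n ^ 2 * Z ^ n = (bc_conj3 W * Z) ^ n / \<beta> n ^ 2" for n Z
    by (simp add: bc_idem_eq_iff power_mult_distrib)
  then show "has_bc_power_series (H2_kernel \<beta> W) (\<lambda>n. bc_conj3 W ^ n / \<beta> n ^ 2)"
    using hardy_weight_summable[OF assms(1) sq] unfolding has_bc_power_series_def H2_kernel_def H2_gen_def
    by (auto intro: summable_sums)
qed

lemma H2_reproducing:
  assumes "hardy_weight \<beta>" and W: "W \<in> bc_disc" and "f \<in> H2 \<beta>"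
  shows "f W = H2_inner \<beta> f (H2_kernel \<beta> W)"
proof -
  obtain b1 b2 where \<beta>: "\<And>n. \<beta> n = bc_idem (complex_of_real (b1 n)) (complex_of_real (b2 n))"
    and pos: "\<And>n. 0 < b1 n" "\<And>n. 0 < b2 n"
    using assms(1) by (rule hardy_weightE) blast
  obtain a where a: "has_bc_power_series f a" "bc_coeffs f = a"
    using assms(3) by (rule H2E) blast
  \<comment> \<open>Conjugating twice restores \<open>W ^ n\<close>. The factor
    \<open>\<beta> n ^ 2\<close> cancels because its components are positive, hence real and
    nonzero.\<close>
  have "a n * bc_conj3 (bc_conj3 W ^ n / \<beta> n ^ 2) * \<beta> n ^ 2 = a n * W ^ n" for n
    using pos[of n] by (simp add: bc_idem_eq_iff bc_conj3_idem \<beta>)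
  then have "H2_inner \<beta> f (H2_kernel \<beta> W) = (\<Sum>n. a n * W ^ n)"
    by (simp add: H2_inner_def a(2) bc_coeffs_eq[OF H2_kernel_power_series(2)[OF assms(1) W]])
  also have "\<dots> = f W"
    using a(1) W unfolding has_bc_power_series_def by (metis sums_unique)
  finally show ?thesis ..
qed

theorem theorem4p6:
  fixes \<beta> :: "nat \<Rightarrow> bicomplex" and W :: bicomplex
  assumes "hardy_weight \<beta>" and "W \<in> bc_disc"
  shows "bc_linear_functional_on (H2 \<beta>) (\<lambda>f. f W) \<and>
         H2_bounded \<beta> (\<lambda>f. f W) \<and>
         H2_kernel \<beta> W \<in> H2 \<beta> \<and>
         (\<forall>f\<in>H2 \<beta>. f W = H2_inner \<beta> f (H2_kernel \<beta> W))"
proof (intro conjI ballI)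
  obtain b1 b2 where "\<And>n. \<beta> n = bc_idem (complex_of_real (b1 n)) (complex_of_real (b2 n))"
    using assms(1) by (rule hardy_weightE) blast
  \<comment> \<open>Evaluation respects pointwise operations by computation; the content is that the
    Hardy space is a module.\<close>
  then show "bc_linear_functional_on (H2 \<beta>) (\<lambda>f. f W)"
    by (simp add: bc_linear_functional_on_def bc_submodule_H2)
  show "H2_kernel \<beta> W \<in> H2 \<beta>"
    using H2_kernel_power_series[OF assms] unfolding H2_def by blast
qed (use assms in \<open>auto intro: H2_bounded_eval H2_reproducing\<close>)

end
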